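(* Let $L_1,\dots,L_n$ and $R_1,\dots,R_n$ be strictly positive operators on a Hilbert space $\mathscr{H}$. Then $$\sum_{i=1}^{n}(L_i-R_i)\leq\sum_{i=1}^{n}L_iR_i^{-1/2}\log\left(R_i^{-1/2}L_iR_i^{-1/2}\right)R_i^{1/2}.$$
   Context: An operator is strictly positive if it is positive and invertible; $X\le Y$ means $Y-X$ is positive. (The right-hand side is self-adjoint, since each summand equals $R_i^{1/2}f(R_i^{-1/2}L_iR_i^{-1/2})R_i^{1/2}$ with $f(t)=t\log t$.) *)

theory Defs
  imports "HOL-Analysis.Analysis" "HOL-Computational_Algebra.Polynomial"
begin

section \<open>Complex Hilbert spaces\<close>

text \<open>
  The norm, metric and topology are those of \<^class>\<open>real_normed_vector\<close>, tied to the inner product by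
  \<open>norm_eq_sqrt_cinner\<close>; hence the library's bounded linear functions can be used.
  The inner product is linear in the first argument.
\<close>

class complex_inner = real_normed_vector +
  fixes scaleC :: "complex \<Rightarrow> 'a \<Rightarrow> 'a"  (infixr "*\<^sub>C" 75)
    and cinner :: "'a \<Rightarrow> 'a \<Rightarrow> complex"
  assumes scaleC_add_right: "c *\<^sub>C (x + y) = c *\<^sub>C x + c *\<^sub>C y"
    and scaleC_add_left: "(c + d) *\<^sub>C x = c *\<^sub>C x + d *\<^sub>C x"
    and scaleC_scaleC: "c *\<^sub>C d *\<^sub>C x = (c * d) *\<^sub>C x"
    and scaleC_one: "1 *\<^sub>C x = x"
    and scaleR_eq_scaleC: "r *\<^sub>R x = complex_of_real r *\<^sub>C x"
    and cinner_commute: "cinner x y = cnj (cinner y x)"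
    and cinner_add_left: "cinner (x + y) z = cinner x z + cinner y z"
    and cinner_scaleC_left: "cinner (c *\<^sub>C x) y = c * cinner x y"
    and cinner_ge_zero: "0 \<le> Re (cinner x x)"
    and cinner_eq_zero_iff: "cinner x x = 0 \<longleftrightarrow> x = 0"
    and norm_eq_sqrt_cinner: "norm x = sqrt (Re (cinner x x))"

class chilbert_space = complex_inner + complete_space

instantiation complex :: chilbert_space
begin

definition "scaleC_complex = ((*) :: complex \<Rightarrow> complex \<Rightarrow> complex)"
definition "cinner_complex = (\<lambda>x y :: complex. x * cnj y)"

instance
  by standard
    (auto simp: scaleC_complex_def cinner_complex_def algebra_simps scaleR_conv_of_real cmod_def power2_eq_square)

end

lemma norm_scaleC: "norm (c *\<^sub>C x) = cmod c * norm (x :: 'a :: complex_inner)"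
proof -
  have "cinner (c *\<^sub>C x) (c *\<^sub>C x) = c * cnj c * cinner x x"
    by (metis cinner_commute cinner_scaleC_left complex_cnj_mult mult.assoc)
  then have "Re (cinner (c *\<^sub>C x) (c *\<^sub>C x)) = (cmod c)\<^sup>2 * Re (cinner x x)"
    by (simp flip: complex_norm_square)
  then show ?thesis
    by (simp add: norm_eq_sqrt_cinner[of x] norm_eq_sqrt_cinner[of "c *\<^sub>C x"] real_sqrt_mult)
qed

section \<open>Operators\<close>

text \<open>
  Operators are bounded. Elements of \<open>'a \<Rightarrow>\<^sub>L 'a\<close> are only real-linear; complex linearity is the
  predicate \<open>clinear_op\<close>, which is part of positivity below.
\<close>

definition clinear_op :: "('a::complex_inner \<Rightarrow>\<^sub>L 'a) \<Rightarrow> bool"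
  where "clinear_op A \<longleftrightarrow> (\<forall>c x. blinfun_apply A (c *\<^sub>C x) = c *\<^sub>C blinfun_apply A x)"

definition positive_op :: "('a::complex_inner \<Rightarrow>\<^sub>L 'a) \<Rightarrow> bool"
  where "positive_op A \<longleftrightarrow> clinear_op A \<and>
    (\<forall>x. cinner (blinfun_apply A x) x \<in> \<real> \<and> 0 \<le> Re (cinner (blinfun_apply A x) x))"

definition invertible_op :: "('a::real_normed_vector \<Rightarrow>\<^sub>L 'a) \<Rightarrow> bool"
  where "invertible_op A \<longleftrightarrow> (\<exists>B. A o\<^sub>L B = id_blinfun \<and> B o\<^sub>L A = id_blinfun)"

definition strictly_positive_op :: "('a::complex_inner \<Rightarrow>\<^sub>L 'a) \<Rightarrow> bool"
  where "strictly_positive_op A \<longleftrightarrow> positive_op A \<and> invertible_op A"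

definition le_op :: "('a::complex_inner \<Rightarrow>\<^sub>L 'a) \<Rightarrow> ('a \<Rightarrow>\<^sub>L 'a) \<Rightarrow> bool"  (infix "\<preceq>" 50)
  where "X \<preceq> Y \<longleftrightarrow> positive_op (Y - X)"

section \<open>Continuous functional calculus\<close>

lift_definition scalar_op :: "complex \<Rightarrow> ('a::complex_inner \<Rightarrow>\<^sub>L 'a)" is "\<lambda>c x. c *\<^sub>C x"
proof (rule bounded_linear_intro)
  fix c :: complex and r :: real and x y :: 'a
  show "c *\<^sub>C (x + y) = c *\<^sub>C x + c *\<^sub>C y"
    by (rule scaleC_add_right)
  show "c *\<^sub>C r *\<^sub>R x = r *\<^sub>R c *\<^sub>C x"
    by (simp add: scaleR_eq_scaleC scaleC_scaleC mult.commute)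
  show "norm (c *\<^sub>C x) \<le> norm x * cmod c"
    by (simp add: norm_scaleC)
qed

definition spectrum_op :: "('a::complex_inner \<Rightarrow>\<^sub>L 'a) \<Rightarrow> complex set"
  where "spectrum_op A = {c. \<not> invertible_op (A - scalar_op c)}"

definition poly_op :: "real poly \<Rightarrow> ('a::real_normed_vector \<Rightarrow>\<^sub>L 'a) \<Rightarrow> ('a \<Rightarrow>\<^sub>L 'a)"
  where "poly_op p A = (\<Sum>k\<le>degree p. coeff p k *\<^sub>R (((o\<^sub>L) A ^^ k) id_blinfun))"

text \<open>
  For self-adjoint \<open>A\<close> (whose spectrum is a compact set of reals) and real-valued \<open>f\<close> continuous on
  the spectrum, \<open>f(A)\<close> is the norm limit of \<open>p\<^sub>n(A)\<close> for any real polynomials \<open>p\<^sub>n\<close> converging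
  to \<open>f\<close> uniformly on the spectrum. For other \<open>A\<close> or \<open>f\<close> the value is of no significance.
\<close>

definition fun_op :: "(real \<Rightarrow> real) \<Rightarrow> ('a::complex_inner \<Rightarrow>\<^sub>L 'a) \<Rightarrow> ('a \<Rightarrow>\<^sub>L 'a)"
  where "fun_op f A = (THE B. \<exists>p :: nat \<Rightarrow> real poly.
    uniform_limit {t. complex_of_real t \<in> spectrum_op A} (\<lambda>n. poly (p n)) f sequentially \<and>
    (\<lambda>n. poly_op (p n) A) \<longlonglongrightarrow> B)"

definition powr_op :: "('a::complex_inner \<Rightarrow>\<^sub>L 'a) \<Rightarrow> real \<Rightarrow> ('a \<Rightarrow>\<^sub>L 'a)"
  where "powr_op A a = fun_op (\<lambda>t. t powr a) A"

definition log_op :: "('a::complex_inner \<Rightarrow>\<^sub>L 'a) \<Rightarrow> ('a \<Rightarrow>\<^sub>L 'a)"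
  where "log_op A = fun_op ln A"

end

theory Submission
  imports Defs "HOL-Computational_Algebra.Fundamental_Theorem_Algebra"
begin

text \<open>
  For a single pair \<open>L, R\<close> put \<open>S = R\<^sup>1\<^sup>/\<^sup>2\<close>, \<open>T = R\<^sup>-\<^sup>1\<^sup>/\<^sup>2\<close> and \<open>B = TLT\<close>. Since \<open>ST = TS = 1\<close>, one has
  \<open>SBS = L\<close> and \<open>LT = SB\<close>, so that the difference of the two sides is
  \<open>S (B log B - B + 1) S\<close>. The operator in the middle is positive because \<open>t log t - t + 1 \<ge> 0\<close> for
  \<open>t > 0\<close>, and conjugation by the self-adjoint \<open>S\<close> preserves positivity
  (\<open>log_op_inequality\<close>). Summing over the pairs gives the theorem.

  Most of the work is the continuous functional calculus for a strictly positive operator \<open>A\<close>: that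
  \<open>f(A)\<close> exists and is unique, is multiplicative in \<open>f\<close>, and is positive if \<open>f \<ge> 0\<close> on the
  spectrum. All of this rests on one estimate for real polynomials \<open>p\<close> and self-adjoint \<open>A\<close>:
  \<open>\<parallel>p(A)\<parallel> \<le> sup \<bar>p\<bar>\<close>, the supremum being over the real spectrum of \<open>A\<close> (\<open>norm_poly_op_le\<close>). It
  has two sources. If \<open>q\<close> is a nonzero real polynomial without zeros on the real spectrum, then
  \<open>q(A)\<close> is invertible, by the factorization of \<open>q\<close> (\<open>poly_op_invertible\<close>). On the other hand,
  \<open>\<parallel>B\<parallel>\<^sup>2 - B\<^sup>2\<close> is never invertible for self-adjoint \<open>B \<noteq> 0\<close> (\<open>norm_square_not_invertible\<close>). With
  \<open>B = p(A)\<close> and \<open>q = \<parallel>B\<parallel>\<^sup>2 - p\<^sup>2\<close> these contradict each other if \<open>\<parallel>B\<parallel> > sup \<bar>p\<bar>\<close>.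

  The spectrum of a strictly positive operator lies in some \<open>[a, b]\<close> with \<open>a > 0\<close>
  (\<open>strictly_positive_real_spectrum\<close>), so that powers and the logarithm are continuous there and
  uniform limits of polynomials.
\<close>

text \<open>This makes the Banach space of bounded operators, hence limits of Cauchy sequences, available.\<close>

instance chilbert_space \<subseteq> banach ..

section \<open>Self-adjoint operators\<close>

lemma cinner_add_right: "cinner x (y + z) = cinner x y + cinner x (z :: 'a :: complex_inner)"
  by (metis cinner_add_left cinner_commute complex_cnj_add)

lemma cinner_scaleC_right: "cinner x (c *\<^sub>C y) = cnj c * cinner x (y :: 'a :: complex_inner)"
  by (metis cinner_commute cinner_scaleC_left complex_cnj_mult)

lemma cinner_scaleR_left: "cinner (r *\<^sub>R x) y = of_real r * cinner x (y :: 'a :: complex_inner)"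
  by (simp add: scaleR_eq_scaleC cinner_scaleC_left)

lemma cinner_scaleR_right: "cinner x (r *\<^sub>R y) = of_real r * cinner x (y :: 'a :: complex_inner)"
  by (simp add: scaleR_eq_scaleC cinner_scaleC_right)

lemma cinner_minus_left: "cinner (- x) y = - cinner x (y :: 'a :: complex_inner)"
  using cinner_scaleR_left[of "-1" x y] by simp

lemma cinner_minus_right: "cinner x (- y) = - cinner x (y :: 'a :: complex_inner)"
  using cinner_scaleR_right[of x "-1" y] by simp

lemma cinner_diff_left: "cinner (x - y) z = cinner x z - cinner y (z :: 'a :: complex_inner)"
  using cinner_add_left[of x "-y" z] by (simp add: cinner_minus_left)

lemma cinner_diff_right: "cinner x (y - z) = cinner x y - cinner x (z :: 'a :: complex_inner)"
  using cinner_add_right[of x y "-z"] by (simp add: cinner_minus_right)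

lemma cinner_zero: "cinner 0 y = 0" "cinner y 0 = 0" for y :: "'a :: complex_inner"
  using cinner_scaleR_left[of 0 y y] cinner_scaleR_right[of y 0 y] by simp_all

lemmas cinner_simps = cinner_add_left cinner_add_right cinner_diff_left cinner_diff_right
  cinner_scaleR_left cinner_scaleR_right cinner_zero

lemma Re_cinner_commute: "Re (cinner x y) = Re (cinner y (x :: 'a :: complex_inner))"
  by (metis cinner_commute complex_cnj cnj.simps(1))

lemma Re_cinner_self: "Re (cinner x x) = (norm x)\<^sup>2" for x :: "'a :: complex_inner"
  by (simp add: norm_eq_sqrt_cinner cinner_ge_zero)

lemma scaleC_scaleR: "c *\<^sub>C r *\<^sub>R x = r *\<^sub>R c *\<^sub>C (x :: 'a :: complex_inner)"
  by (simp add: scaleR_eq_scaleC scaleC_scaleC mult.commute)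

definition selfadjoint_op :: "('a::complex_inner \<Rightarrow>\<^sub>L 'a) \<Rightarrow> bool"
  where "selfadjoint_op A \<longleftrightarrow> clinear_op A \<and> (\<forall>x y. cinner (A x) y = cinner x (A y))"

lemma selfadjoint_cinner: "selfadjoint_op A \<Longrightarrow> cinner (A x) y = cinner x (A y)"
  by (simp add: selfadjoint_op_def)

lemma selfadjoint_id: "selfadjoint_op id_blinfun"
  by (simp add: selfadjoint_op_def clinear_op_def)

lemma selfadjoint_add: "selfadjoint_op A \<Longrightarrow> selfadjoint_op B \<Longrightarrow> selfadjoint_op (A + B)"
  by (simp add: selfadjoint_op_def clinear_op_def blinfun.bilinear_simps cinner_simps scaleC_add_right)

lemma selfadjoint_scaleR: "selfadjoint_op A \<Longrightarrow> selfadjoint_op (r *\<^sub>R A)"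
  by (simp add: selfadjoint_op_def clinear_op_def blinfun.bilinear_simps cinner_simps scaleC_scaleR)

lemma selfadjoint_compose_commute:
  assumes "selfadjoint_op A" "selfadjoint_op B" "A o\<^sub>L B = B o\<^sub>L A"
  shows "selfadjoint_op (A o\<^sub>L B)"
proof -
  have "A (B x) = B (A x)" for x
    using assms(3) by (metis blinfun_apply_blinfun_compose)
  with assms show ?thesis
    by (simp add: selfadjoint_op_def clinear_op_def)
qed

lemma selfadjoint_congruence:
  assumes "selfadjoint_op S" "selfadjoint_op A"
  shows "selfadjoint_op (S o\<^sub>L A o\<^sub>L S)"
  using assms by (simp add: selfadjoint_op_def clinear_op_def)

text \<open>
  Expand the real quantities \<open>\<langle>A(x+y),x+y\<rangle>\<close> and \<open>\<langle>A(x+iy),x+iy\<rangle>\<close>: they determine the real and the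
  imaginary part of \<open>\<langle>Ax,y\<rangle> - \<langle>x,Ay\<rangle>\<close>. This is where the complex scalars matter.
\<close>

lemma positive_imp_selfadjoint:
  assumes "positive_op A"
  shows "selfadjoint_op A"
proof -
  have clin: "A (c *\<^sub>C x) = c *\<^sub>C A x" for c x
    using assms by (simp add: positive_op_def clinear_op_def)
  have real: "cinner (A x) x = cinner x (A x)" for x
  proof -
    have "cinner (A x) x \<in> \<real>"
      using assms by (simp add: positive_op_def)
    then show ?thesis
      using cinner_commute[of x "A x"] by (simp add: Reals_cnj_iff)
  qed
  have "cinner (A x) y = cinner x (A y)" for x y
  proof -
    have 1: "cinner (A x) y + cinner (A y) x = cinner x (A y) + cinner y (A x)"
      using real[of "x + y"] real[of x] real[of y]
      by (simp add: blinfun.bilinear_simps cinner_simps algebra_simps)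
    have 2: "\<i> * cinner (A y) x - \<i> * cinner (A x) y = \<i> * cinner y (A x) - \<i> * cinner x (A y)"
      using real[of "x + \<i> *\<^sub>C y"] real[of x] real[of y]
      by (simp add: blinfun.bilinear_simps cinner_simps clin cinner_scaleC_left cinner_scaleC_right
          algebra_simps)
    have "\<i> * (cinner (A y) x - cinner (A x) y) = \<i> * (cinner y (A x) - cinner x (A y))"
      using 2 by (simp add: algebra_simps)
    then have "cinner (A y) x - cinner (A x) y = cinner y (A x) - cinner x (A y)"
      by (metis complex_i_not_zero mult_left_cancel)
    with 1 have "2 * cinner (A x) y = 2 * cinner x (A y)"
      by algebra
    then show ?thesis by simp
  qed
  then show ?thesis
    using assms by (simp add: selfadjoint_op_def positive_op_def)
qed

lemma positive_op_iff:
  "positive_op A \<longleftrightarrow> selfadjoint_op A \<and> (\<forall>x. 0 \<le> Re (cinner (A x) x))"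
proof -
  have "cinner (A x) x \<in> \<real>" if "selfadjoint_op A" for x
    by (metis that cinner_commute Reals_cnj_iff selfadjoint_cinner)
  moreover have "selfadjoint_op A \<Longrightarrow> clinear_op A"
    by (simp add: selfadjoint_op_def)
  ultimately show ?thesis
    using positive_imp_selfadjoint[of A] unfolding positive_op_def by blast
qed

lemma positive_id: "positive_op id_blinfun"
  by (simp add: positive_op_iff selfadjoint_id cinner_ge_zero)

lemma positive_add: "positive_op A \<Longrightarrow> positive_op B \<Longrightarrow> positive_op (A + B)"
  by (simp add: positive_op_iff selfadjoint_add blinfun.bilinear_simps cinner_simps)

lemma positive_zero: "positive_op 0"
  using selfadjoint_scaleR[OF selfadjoint_id, of 0]
  by (simp add: positive_op_iff cinner_simps)

lemma positive_sum: "(\<And>i. i \<in> I \<Longrightarrow> positive_op (A i)) \<Longrightarrow> positive_op (\<Sum>i\<in>I. A i)"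
  by (induction I rule: infinite_finite_induct) (auto simp: positive_zero positive_add)

lemma positive_congruence:
  assumes "selfadjoint_op S" "positive_op A"
  shows "positive_op (S o\<^sub>L A o\<^sub>L S)"
  using assms by (simp add: positive_op_iff selfadjoint_congruence selfadjoint_cinner[of S])

text \<open>The Cauchy-Schwarz inequality for the semi-inner product \<open>(x, y) \<mapsto> \<langle>Ax,y\<rangle>\<close>.\<close>

lemma positive_cauchy_schwarz:
  assumes "positive_op A"
  shows "(Re (cinner (A x) y))\<^sup>2 \<le> Re (cinner (A x) x) * Re (cinner (A y) y)"
proof -
  define a b c where "a = Re (cinner (A x) x)" and "b = Re (cinner (A x) y)"
    and "c = Re (cinner (A y) y)"
  have pos: "0 \<le> Re (cinner (A z) z)" for z
    using assms by (simp add: positive_op_def)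
  have sym: "Re (cinner (A y) x) = b"
    using assms Re_cinner_commute[of y "A x"]
    by (simp add: b_def positive_op_iff selfadjoint_cinner[of A y x])
  have quad: "0 \<le> a + 2 * s * b + s\<^sup>2 * c" for s
    using pos[of "x + s *\<^sub>R y"] sym unfolding a_def b_def c_def
    by (simp add: blinfun.bilinear_simps cinner_simps algebra_simps power2_eq_square)
  have "b\<^sup>2 \<le> a * c"
  proof (cases "c = 0")
    case True
    have "b = 0"
    proof (rule ccontr)
      assume "b \<noteq> 0"
      \<comment> \<open>at this value of \<open>s\<close> the quadratic is \<open>-1\<close>\<close>
      then show False
        using quad[of "- (a + 1) / (2 * b)"] True by (simp add: field_simps)
    qed
    with True show ?thesis by simp
  next
    case False
    with pos[of y] have "c > 0" by (simp add: c_def)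
    then show ?thesis
      using quad[of "- b / c"] by (simp add: field_simps power2_eq_square)
  qed
  then show ?thesis by (simp add: a_def b_def c_def)
qed

lemma Re_cinner_le_norm: "Re (cinner x y) \<le> norm x * norm y" for x y :: "'a::complex_inner"
proof -
  have "(Re (cinner x y))\<^sup>2 \<le> (norm x * norm y)\<^sup>2"
    using positive_cauchy_schwarz[OF positive_id, of x y] by (simp add: Re_cinner_self power_mult_distrib)
  then show ?thesis
    by (rule power2_le_imp_le) simp
qed

lemma bounded_bilinear_cinner: "bounded_bilinear (cinner :: 'a::complex_inner \<Rightarrow> 'a \<Rightarrow> complex)"
proof (standard, goal_cases)
  case 5
  have re: "\<bar>Re (cinner x y)\<bar> \<le> norm x * norm y" for x y :: 'a
    using Re_cinner_le_norm[of x y] Re_cinner_le_norm[of "- x" y] by (simp add: cinner_minus_left)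
  have "norm (cinner x y) \<le> norm x * norm y * 2" for x y :: 'a
  proof -
    have "norm (cinner x y) \<le> \<bar>Re (cinner x y)\<bar> + \<bar>Re (cinner (\<i> *\<^sub>C x) y)\<bar>"
      using cmod_le[of "cinner x y"] by (simp add: cinner_scaleC_left)
    also have "\<dots> \<le> norm x * norm y * 2"
      using re[of x y] re[of "\<i> *\<^sub>C x" y] by (simp add: norm_scaleC)
    finally show ?thesis .
  qed
  then show ?case by blast
qed (simp_all add: cinner_simps scaleR_conv_of_real)

section \<open>Invertibility\<close>

lemma invertible_compose: "invertible_op A \<Longrightarrow> invertible_op B \<Longrightarrow> invertible_op (A o\<^sub>L B)"
proof -
  assume "invertible_op A" "invertible_op B"
  then obtain A' B' where "A o\<^sub>L A' = id_blinfun" "A' o\<^sub>L A = id_blinfun"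
    "B o\<^sub>L B' = id_blinfun" "B' o\<^sub>L B = id_blinfun"
    by (auto simp: invertible_op_def)
  then have "A (A' x) = x" "A' (A x) = x" "B (B' x) = x" "B' (B x) = x" for x
    by (metis blinfun_apply_blinfun_compose blinfun_apply_id_blinfun id_apply)+
  then have "(A o\<^sub>L B) o\<^sub>L (B' o\<^sub>L A') = id_blinfun" "(B' o\<^sub>L A') o\<^sub>L (A o\<^sub>L B) = id_blinfun"
    by (auto intro!: blinfun_eqI)
  then show ?thesis
    unfolding invertible_op_def by blast
qed

lemma invertible_bounded_below:
  assumes "invertible_op A"
  obtains k where "k > 0" "\<And>x. norm x \<le> k * norm (A x)"
proof -
  obtain B where B: "B o\<^sub>L A = id_blinfun"
    using assms by (auto simp: invertible_op_def)
  have "norm x \<le> (norm B + 1) * norm (A x)" for x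
  proof -
    have "x = B (A x)"
      using B by (metis blinfun_apply_blinfun_compose blinfun_apply_id_blinfun id_apply)
    then have "norm x \<le> norm B * norm (A x)"
      by (metis norm_blinfun)
    then show ?thesis
      by (simp add: distrib_right add_increasing2)
  qed
  moreover have "norm B + 1 > 0"
    by (simp add: add_nonneg_pos)
  ultimately show ?thesis using that by blast
qed

text \<open>
  The Lax-Milgram argument: for small \<open>s > 0\<close> the map \<open>x \<mapsto> x - s(Cx - y)\<close> is a contraction, since
  \<open>\<parallel>x - sCx\<parallel>\<^sup>2 \<le> (1 - 2sd + s\<^sup>2\<parallel>C\<parallel>\<^sup>2) \<parallel>x\<parallel>\<^sup>2\<close>. Its fixed point solves \<open>Cx = y\<close>.
\<close>

lemma coercive_invertible:
  fixes C :: "'a::chilbert_space \<Rightarrow>\<^sub>L 'a"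
  assumes d: "d > 0" and coercive: "\<And>x. d * (norm x)\<^sup>2 \<le> Re (cinner (C x) x)"
  shows "invertible_op C"
proof -
  have below: "d * norm x \<le> norm (C x)" for x
  proof (cases "x = 0")
    case False
    have "d * (norm x)\<^sup>2 \<le> norm (C x) * norm x"
      using coercive[of x] Re_cinner_le_norm[of "C x" x] by linarith
    with False show ?thesis
      by (simp add: power2_eq_square mult.assoc[symmetric])
  qed simp
  have inj: "inj C"
  proof (rule injI)
    fix x y assume "C x = C y"
    then have "C (x - y) = 0" by (simp add: blinfun.bilinear_simps)
    with below[of "x - y"] d show "x = y" by (simp add: mult_le_0_iff)
  qed
  have surj: "\<exists>x. C x = y" for y
  proof -
    define M where "M = norm C + d"
    \<comment> \<open>the minimizer of \<open>1 - 2sd + s\<^sup>2M\<^sup>2\<close>, with minimum \<open>c\<^sup>2\<close>\<close>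
    define s where "s = d / M\<^sup>2"
    define c where "c = sqrt (1 - d\<^sup>2 / M\<^sup>2)"
    have M: "M > 0" "d \<le> M" "norm C \<le> M"
      using d by (auto simp: M_def add_nonneg_pos)
    have s: "s > 0" using M d by (simp add: s_def)
    have q: "0 < d\<^sup>2 / M\<^sup>2" "d\<^sup>2 / M\<^sup>2 \<le> 1"
      using M d by (auto simp: power_mono)
    have c: "0 \<le> c" "c < 1" "c\<^sup>2 = 1 - d\<^sup>2 / M\<^sup>2"
      using q by (auto simp: c_def)
    have contr: "norm (x - s *\<^sub>R C x) \<le> c * norm x" for x
    proof (rule power2_le_imp_le)
      have "norm (C x) \<le> M * norm x"
        using norm_blinfun[of C x] M by (meson mult_right_mono norm_ge_zero order_trans)
      then have "(norm (C x))\<^sup>2 \<le> M\<^sup>2 * (norm x)\<^sup>2"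
        by (metis norm_ge_zero power_mono power_mult_distrib)
      then have 1: "s\<^sup>2 * (norm (C x))\<^sup>2 \<le> s\<^sup>2 * (M\<^sup>2 * (norm x)\<^sup>2)"
        by (simp add: mult_left_mono)
      have 2: "s * (d * (norm x)\<^sup>2) \<le> s * Re (cinner (C x) x)"
        using s coercive by (simp add: mult_left_mono)
      have "(norm (x - s *\<^sub>R C x))\<^sup>2
        = (norm x)\<^sup>2 - 2 * (s * Re (cinner (C x) x)) + s\<^sup>2 * (norm (C x))\<^sup>2"
        unfolding Re_cinner_self[symmetric] using Re_cinner_commute[of x "C x"]
        by (simp add: cinner_simps algebra_simps power2_eq_square)
      also have "\<dots> \<le> (norm x)\<^sup>2 - 2 * (s * (d * (norm x)\<^sup>2)) + s\<^sup>2 * (M\<^sup>2 * (norm x)\<^sup>2)"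
        using 1 2 by linarith
      also have "\<dots> = (1 - d\<^sup>2 / M\<^sup>2) * (norm x)\<^sup>2"
        using M by (simp add: s_def field_simps power2_eq_square)
      also have "\<dots> = (c * norm x)\<^sup>2"
        by (simp add: c power_mult_distrib)
      finally show "(norm (x - s *\<^sub>R C x))\<^sup>2 \<le> (c * norm x)\<^sup>2" .
    qed (use c in simp)
    have "dist (x - s *\<^sub>R (C x - y)) (z - s *\<^sub>R (C z - y)) \<le> c * dist x z" for x z
    proof -
      have "(x - s *\<^sub>R (C x - y)) - (z - s *\<^sub>R (C z - y)) = (x - z) - s *\<^sub>R C (x - z)"
        by (simp add: blinfun.bilinear_simps algebra_simps)
      then show ?thesis
        using contr[of "x - z"] unfolding dist_norm by metis
    qed
    then have "\<exists>!x. x - s *\<^sub>R (C x - y) = x"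
      using banach_fix_type[OF c(1,2), of "\<lambda>x. x - s *\<^sub>R (C x - y)"] by blast
    then show ?thesis using s by auto
  qed
  define g where "g = inv C"
  have Cg: "C (g y) = y" for y
    unfolding g_def by (metis surj f_inv_into_f rangeI)
  have gC: "g (C x) = x" for x
    using inj by (simp add: g_def)
  have lin: "g (x + y) = g x + g y" "g (r *\<^sub>R x) = r *\<^sub>R g x" for x y r
    by (metis Cg gC blinfun.add_right, metis Cg gC blinfun.scaleR_right)
  have "bounded_linear g"
  proof (rule bounded_linear_intro)
    show "norm (g y) \<le> norm y * (1 / d)" for y
      using below[of "g y"] d by (simp add: Cg field_simps)
  qed (use lin in auto)
  then have "blinfun_apply (Blinfun g) = g"
    by (rule bounded_linear_Blinfun_apply)
  then have "C o\<^sub>L Blinfun g = id_blinfun" "Blinfun g o\<^sub>L C = id_blinfun"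
    by (auto intro!: blinfun_eqI simp: Cg gC)
  then show ?thesis
    unfolding invertible_op_def by blast
qed

text \<open>
  Cauchy-Schwarz for the form of \<open>A\<close> gives \<open>\<parallel>Ax\<parallel>\<^sup>2 \<le> \<parallel>A\<parallel> \<langle>Ax,x\<rangle>\<close>, and \<open>\<parallel>Ax\<parallel>\<close> bounds \<open>\<parallel>x\<parallel>\<close>.
\<close>

lemma strictly_positive_coercive:
  assumes "strictly_positive_op A"
  obtains d where "d > 0" "\<And>x. d * (norm x)\<^sup>2 \<le> Re (cinner (A x) x)"
proof -
  have pos: "positive_op A" and inv: "invertible_op A"
    using assms by (auto simp: strictly_positive_op_def)
  obtain k where k: "k > 0" "\<And>x. norm x \<le> k * norm (A x)"
    using invertible_bounded_below[OF inv] by blast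
  define N where "N = norm A + 1"
  have N: "N > 0" "norm A \<le> N" by (auto simp: N_def add_nonneg_pos)
  have "1 / (N * k\<^sup>2) * (norm x)\<^sup>2 \<le> Re (cinner (A x) x)" for x
  proof (cases "A x = 0")
    case True
    then have "x = 0" using k(2)[of x] by simp
    then show ?thesis by (simp add: cinner_zero)
  next
    case False
    have q: "0 \<le> Re (cinner (A x) x)"
      using pos by (simp add: positive_op_def)
    have "Re (cinner (A (A x)) (A x)) \<le> norm (A (A x)) * norm (A x)"
      by (rule Re_cinner_le_norm)
    also have "\<dots> \<le> (N * norm (A x)) * norm (A x)"
      using norm_blinfun[of A "A x"] N by (meson mult_right_mono norm_ge_zero order_trans)
    finally have *: "Re (cinner (A (A x)) (A x)) \<le> N * (norm (A x))\<^sup>2"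
      by (simp add: power2_eq_square)
    have "((norm (A x))\<^sup>2)\<^sup>2 \<le> Re (cinner (A x) x) * Re (cinner (A (A x)) (A x))"
      using positive_cauchy_schwarz[OF pos, of x "A x"] by (simp add: Re_cinner_self)
    also have "\<dots> \<le> Re (cinner (A x) x) * (N * (norm (A x))\<^sup>2)"
      using * q by (rule mult_left_mono)
    finally have "(norm (A x))\<^sup>2 * (norm (A x))\<^sup>2 \<le> (N * Re (cinner (A x) x)) * (norm (A x))\<^sup>2"
      by (simp add: power2_eq_square ac_simps)
    then have le: "(norm (A x))\<^sup>2 \<le> N * Re (cinner (A x) x)"
      using False by (meson mult_le_cancel_right_pos zero_less_norm_iff zero_less_power)
    have "(norm x)\<^sup>2 \<le> k\<^sup>2 * (norm (A x))\<^sup>2"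
      using k(2)[of x] by (metis norm_ge_zero power_mono power_mult_distrib)
    also have "\<dots> \<le> k\<^sup>2 * (N * Re (cinner (A x) x))"
      using le by (simp add: mult_left_mono)
    finally show ?thesis
      using k N by (simp add: field_simps)
  qed
  moreover have "1 / (N * k\<^sup>2) > 0" using k N by simp
  ultimately show ?thesis using that by blast
qed

section \<open>Real spectrum and polynomials\<close>

abbreviation real_spectrum :: "('a::complex_inner \<Rightarrow>\<^sub>L 'a) \<Rightarrow> real set"
  where "real_spectrum A \<equiv> {t. complex_of_real t \<in> spectrum_op A}"

lemma scalar_op_of_real: "scalar_op (complex_of_real r) = r *\<^sub>R id_blinfun"
  by (rule blinfun_eqI) (simp add: scalar_op.rep_eq scaleR_eq_scaleC blinfun.scaleR_left)

lemma real_spectrum_iff: "t \<in> real_spectrum A \<longleftrightarrow> \<not> invertible_op (A - t *\<^sub>R id_blinfun)"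
  by (simp add: spectrum_op_def scalar_op_of_real)

lemma invertible_uminus:
  assumes "invertible_op (A :: 'a::real_normed_vector \<Rightarrow>\<^sub>L 'a)"
  shows "invertible_op (- A)"
proof -
  obtain B where "A o\<^sub>L B = id_blinfun" "B o\<^sub>L A = id_blinfun"
    using assms by (auto simp: invertible_op_def)
  then have "(- A) o\<^sub>L (- B) = id_blinfun" "(- B) o\<^sub>L (- A) = id_blinfun"
    by (auto simp: bounded_bilinear.minus_left[OF bounded_bilinear_blinfun_compose]
        bounded_bilinear.minus_right[OF bounded_bilinear_blinfun_compose])
  then show ?thesis
    unfolding invertible_op_def by blast
qed

lemma real_spectrum_le:
  fixes A :: "'a::chilbert_space \<Rightarrow>\<^sub>L 'a"
  assumes "t \<in> real_spectrum A"
  shows "t \<le> norm A"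
proof (rule ccontr)
  assume "\<not> t \<le> norm A"
  then have t: "t - norm A > 0" by simp
  have "(t - norm A) * (norm x)\<^sup>2 \<le> Re (cinner ((t *\<^sub>R id_blinfun - A) x) x)" for x
  proof -
    have "Re (cinner (A x) x) \<le> norm (A x) * norm x"
      by (rule Re_cinner_le_norm)
    also have "\<dots> \<le> norm A * (norm x)\<^sup>2"
      using mult_right_mono[OF norm_blinfun[of A x] norm_ge_zero[of x]]
      by (simp add: power2_eq_square mult.assoc)
    finally show ?thesis
      by (simp add: blinfun.bilinear_simps cinner_simps Re_cinner_self algebra_simps)
  qed
  then have "invertible_op (t *\<^sub>R id_blinfun - A)"
    using t coercive_invertible by blast
  then have "invertible_op (A - t *\<^sub>R id_blinfun)"
    using invertible_uminus by fastforce
  then show False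
    using assms real_spectrum_iff by blast
qed

lemma real_spectrum_ge:
  fixes A :: "'a::chilbert_space \<Rightarrow>\<^sub>L 'a"
  assumes "t \<in> real_spectrum A" "\<And>x. d * (norm x)\<^sup>2 \<le> Re (cinner (A x) x)"
  shows "d \<le> t"
proof (rule ccontr)
  assume "\<not> d \<le> t"
  then have "d - t > 0" by simp
  moreover have "(d - t) * (norm x)\<^sup>2 \<le> Re (cinner ((A - t *\<^sub>R id_blinfun) x) x)" for x
    using assms(2)[of x]
    by (simp add: blinfun.bilinear_simps cinner_simps Re_cinner_self algebra_simps)
  ultimately have "invertible_op (A - t *\<^sub>R id_blinfun)"
    using coercive_invertible by blast
  then show False
    using assms(1) real_spectrum_iff by blast
qed

lemma strictly_positive_real_spectrum:
  fixes A :: "'a::chilbert_space \<Rightarrow>\<^sub>L 'a"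
  assumes "strictly_positive_op A"
  obtains a b where "0 < a" "a \<le> b" "real_spectrum A \<subseteq> {a..b}"
proof -
  obtain d where d: "d > 0" "\<And>x. d * (norm x)\<^sup>2 \<le> Re (cinner (A x) x)"
    using strictly_positive_coercive[OF assms] by blast
  have "real_spectrum A \<subseteq> {d..max d (norm A)}"
    using real_spectrum_ge[OF _ d(2)] real_spectrum_le[of _ A] by fastforce
  with d(1) that[of d "max d (norm A)"] show ?thesis by simp
qed

lemma blinfun_compose_assoc: "(A o\<^sub>L B) o\<^sub>L C = A o\<^sub>L (B o\<^sub>L C)"
  by (rule blinfun_eqI) simp

lemma blinfun_compose_id: "A o\<^sub>L id_blinfun = A" "id_blinfun o\<^sub>L A = A"
  by (auto intro: blinfun_eqI)

lemmas compose_simps =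
  bounded_bilinear.add_left[OF bounded_bilinear_blinfun_compose]
  bounded_bilinear.add_right[OF bounded_bilinear_blinfun_compose]
  bounded_bilinear.diff_left[OF bounded_bilinear_blinfun_compose]
  bounded_bilinear.diff_right[OF bounded_bilinear_blinfun_compose]
  bounded_bilinear.scaleR_left[OF bounded_bilinear_blinfun_compose]
  bounded_bilinear.scaleR_right[OF bounded_bilinear_blinfun_compose]
  bounded_bilinear.zero_left[OF bounded_bilinear_blinfun_compose]
  bounded_bilinear.zero_right[OF bounded_bilinear_blinfun_compose]
  blinfun_compose_id

lemma poly_op_upto:
  assumes "degree p \<le> N"
  shows "poly_op p A = (\<Sum>k\<le>N. coeff p k *\<^sub>R (((o\<^sub>L) A ^^ k) id_blinfun))"
  unfolding poly_op_def using assms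
  by (intro sum.mono_neutral_left) (auto simp: coeff_eq_0 not_le)

lemma poly_op_0: "poly_op 0 A = 0"
  by (simp add: poly_op_def)

lemma poly_op_pCons: "poly_op (pCons a p) A = a *\<^sub>R id_blinfun + (A o\<^sub>L poly_op p A)"
proof -
  have "poly_op (pCons a p) A =
    (\<Sum>k\<le>Suc (degree p). coeff (pCons a p) k *\<^sub>R (((o\<^sub>L) A ^^ k) id_blinfun))"
    by (rule poly_op_upto) (simp add: degree_pCons_le)
  also have "\<dots> = a *\<^sub>R id_blinfun + (\<Sum>k\<le>degree p. A o\<^sub>L (coeff p k *\<^sub>R (((o\<^sub>L) A ^^ k) id_blinfun)))"
    by (simp add: sum.atMost_Suc_shift compose_simps del: sum.atMost_Suc)
  also have "\<dots> = a *\<^sub>R id_blinfun + (A o\<^sub>L poly_op p A)"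
    by (simp add: poly_op_def bounded_bilinear.sum_right[OF bounded_bilinear_blinfun_compose])
  finally show ?thesis .
qed

lemma poly_op_const: "poly_op [:c:] A = c *\<^sub>R id_blinfun"
  by (simp add: poly_op_pCons poly_op_0 compose_simps)

lemma poly_op_X: "poly_op [:0, 1:] A = A"
  by (simp add: poly_op_pCons poly_op_0 compose_simps)

lemma poly_op_add: "poly_op (p + q) A = poly_op p A + poly_op q A"
proof (induction p q rule: poly_induct2)
  case (pCons a p b q)
  then show ?case
    by (simp add: poly_op_pCons compose_simps algebra_simps)
qed (simp add: poly_op_0)

lemma poly_op_smult: "poly_op (smult c p) A = c *\<^sub>R poly_op p A"
  by (induction p) (simp_all add: poly_op_0 poly_op_pCons compose_simps scaleR_add_right)

lemma poly_op_diff: "poly_op (p - q) A = poly_op p A - poly_op q A"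
  using poly_op_add[of "p - q" q A] by (simp add: algebra_simps)

lemma poly_op_mult: "poly_op (p * q) A = poly_op p A o\<^sub>L poly_op q A"
  by (induction p)
    (simp_all add: poly_op_0 poly_op_pCons poly_op_add poly_op_smult compose_simps
      mult_pCons_left blinfun_compose_assoc)

lemma poly_op_commute: "poly_op p A o\<^sub>L poly_op q A = poly_op q A o\<^sub>L poly_op p A"
  by (metis poly_op_mult mult.commute)

lemma selfadjoint_poly_op:
  assumes "selfadjoint_op A"
  shows "selfadjoint_op (poly_op p A)"
proof (induction p)
  case 0
  show ?case
    using selfadjoint_scaleR[OF selfadjoint_id, of 0] by (simp add: poly_op_0)
next
  case (pCons a p)
  have "A o\<^sub>L poly_op p A = poly_op p A o\<^sub>L A"
    using poly_op_commute[of "[:0, 1:]" A p] by (simp add: poly_op_X)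
  then show ?case
    using pCons assms
    by (simp add: poly_op_pCons selfadjoint_add selfadjoint_scaleR selfadjoint_id
        selfadjoint_compose_commute)
qed

text \<open>
  Evaluation at \<open>z\<close> is a ring homomorphism \<open>h\<close> that kills the quadratic, hence also the remainder,
  which has degree at most one; but \<open>h(a + bX) = a + bz\<close> vanishes only for \<open>a = b = 0\<close>.
\<close>

lemma complex_root_imp_quadratic_dvd:
  fixes p :: "real poly"
  assumes "poly (map_poly complex_of_real p) z = 0" "Im z \<noteq> 0"
  shows "[:(cmod z)\<^sup>2, - 2 * Re z, 1:] dvd p"
proof -
  define h where "h = (\<lambda>p. poly (map_poly complex_of_real p) z)"
  have h_pCons: "h (pCons a p) = complex_of_real a + z * h p" for a p
    by (simp add: h_def map_poly_pCons)
  have h_0: "h 0 = 0"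
    by (simp add: h_def)
  have h_add: "h (p + q) = h p + h q" for p q
    by (induction p q rule: poly_induct2) (simp_all add: h_0 h_pCons algebra_simps)
  have h_smult: "h (smult c p) = complex_of_real c * h p" for c p
    by (induction p) (simp_all add: h_0 h_pCons algebra_simps)
  have h_mult: "h (p * q) = h p * h q" for p q
    by (induction p) (simp_all add: h_0 h_pCons h_add h_smult algebra_simps)
  define w where "w = [:(cmod z)\<^sup>2, - 2 * Re z, 1:]"
  have "h w = complex_of_real ((cmod z)\<^sup>2) + z * (z - 2 * Re z)"
    by (simp add: w_def h_pCons h_0 algebra_simps)
  also have "\<dots> = 0"
    unfolding cmod_power2 by (simp add: complex_eq_iff power2_eq_square algebra_simps)
  finally have hw: "h w = 0" .
  have "degree (p mod w) < 2 \<or> p mod w = 0"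
    using degree_mod_less[of w p] by (auto simp: w_def)
  then have "degree (p mod w) \<le> 1"
    by auto
  then obtain a b where ab: "p mod w = [:a, b:]"
    using degree1_coeffs by (metis One_nat_def degree_0_id degree_eq_zeroE le_Suc_eq le_zero_eq pCons_0_0)
  have "h p = h w * h (p div w) + h (p mod w)"
    by (metis h_add h_mult mult_div_mod_eq)
  moreover have "h p = 0"
    using assms(1) by (simp add: h_def)
  ultimately have "h (p mod w) = 0"
    by (simp add: hw)
  then have "complex_of_real a + z * complex_of_real b = 0"
    by (simp add: ab h_pCons h_0)
  then have "b = 0" "a = 0"
    using assms(2) by (auto simp: complex_eq_iff)
  then have "p mod w = 0" by (simp add: ab)
  then show ?thesis by (simp add: w_def mod_eq_0_iff_dvd)
qed

text \<open>The polynomial is \<open>(X - Re z)\<^sup>2 + (Im z)\<^sup>2\<close>, so its value at \<open>A\<close> is at least \<open>(Im z)\<^sup>2\<close>.\<close>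

lemma quadratic_op_invertible:
  fixes A :: "'a::chilbert_space \<Rightarrow>\<^sub>L 'a"
  assumes "selfadjoint_op A" "Im z \<noteq> 0"
  shows "invertible_op (poly_op [:(cmod z)\<^sup>2, - 2 * Re z, 1:] A)"
proof (rule coercive_invertible)
  show "(Im z)\<^sup>2 > 0" using assms by simp
  fix x
  have "(Im z)\<^sup>2 * (norm x)\<^sup>2 \<le> (Im z)\<^sup>2 * (norm x)\<^sup>2 + (norm (A x - Re z *\<^sub>R x))\<^sup>2"
    by simp
  also have "\<dots> = Re (cinner ((poly_op [:(cmod z)\<^sup>2, - 2 * Re z, 1:] A) x) x)"
    using selfadjoint_cinner[OF assms(1)]
    unfolding Re_cinner_self[where 'a='a, symmetric] cmod_power2
    by (simp add: poly_op_pCons poly_op_0 compose_simps blinfun.bilinear_simps cinner_simps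
        power2_eq_square algebra_simps)
  finally show "(Im z)\<^sup>2 * (norm x)\<^sup>2 \<le> Re (cinner ((poly_op [:(cmod z)\<^sup>2, - 2 * Re z, 1:] A) x) x)" .
qed

text \<open>
  The half of the spectral mapping theorem that bounds norms. A real polynomial splits into real
  linear factors, invertible at \<open>A\<close> because their roots lie outside the spectrum, and real
  quadratic factors without real roots, invertible at \<open>A\<close> by the preceding lemma.
\<close>

lemma poly_op_invertible:
  fixes A :: "'a::chilbert_space \<Rightarrow>\<^sub>L 'a"
  assumes "selfadjoint_op A" "p \<noteq> 0" "\<And>t. t \<in> real_spectrum A \<Longrightarrow> poly p t \<noteq> 0"
  shows "invertible_op (poly_op p A)"
  using assms(2,3)
proof (induction "degree p" arbitrary: p rule: less_induct)
  case less
  have split: "invertible_op (poly_op p A)"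
    if q: "invertible_op (poly_op q A)" "degree q > 0" "q dvd p" for q
  proof -
    obtain r where r: "p = q * r" using q by blast
    with less.prems have "q \<noteq> 0" "r \<noteq> 0" by auto
    then have "degree r < degree p" using q r by (simp add: degree_mult_eq)
    moreover have "poly r t \<noteq> 0" if "t \<in> real_spectrum A" for t
      using less.prems(2)[OF that] by (simp add: r)
    ultimately have "invertible_op (poly_op r A)"
      using less.hyps \<open>r \<noteq> 0\<close> by blast
    then show ?thesis
      using q by (simp add: r poly_op_mult invertible_compose)
  qed
  show ?case
  proof (cases "degree p = 0")
    case True
    then obtain c where c: "p = [:c:]" by (meson degree_eq_zeroE)
    with less.prems have "c \<noteq> 0" by auto
    then show ?thesis
      unfolding invertible_op_def c poly_op_const
      by (intro exI[of _ "(1 / c) *\<^sub>R id_blinfun"]) (simp add: compose_simps)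
  next
    case False
    then have "\<not> constant (poly (map_poly complex_of_real p))"
      by (simp add: constant_degree degree_map_poly)
    then obtain z where z: "poly (map_poly complex_of_real p) z = 0"
      using fundamental_theorem_of_algebra by blast
    show ?thesis
    proof (cases "Im z = 0")
      case True
      define t where "t = Re z"
      have zt: "z = complex_of_real t" using True by (simp add: t_def complex_eq_iff)
      have "poly (map_poly complex_of_real p) (complex_of_real t) = complex_of_real (poly p t)"
        by (induction p) (simp_all add: map_poly_pCons)
      with z zt have root: "poly p t = 0" by simp
      then have "invertible_op (A - t *\<^sub>R id_blinfun)"
        using less.prems(2)[of t] real_spectrum_iff[of t A] by blast
      moreover have "poly_op [:- t, 1:] A = A - t *\<^sub>R id_blinfun"
        by (simp add: poly_op_pCons poly_op_0 compose_simps)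
      ultimately show ?thesis
        using split[of "[:- t, 1:]"] root by (simp add: poly_eq_0_iff_dvd)
    next
      case False
      with z show ?thesis
        using split[of "[:(cmod z)\<^sup>2, - 2 * Re z, 1:]"] complex_root_imp_quadratic_dvd[of p z]
          quadratic_op_invertible[OF assms(1)] by simp
    qed
  qed
qed

text \<open>
  With \<open>m = \<parallel>B\<parallel>\<close> one has \<open>\<parallel>(m\<^sup>2 - B\<^sup>2)x\<parallel>\<^sup>2 \<le> m\<^sup>2 (m\<^sup>2\<parallel>x\<parallel>\<^sup>2 - \<parallel>Bx\<parallel>\<^sup>2)\<close>. If \<open>m\<^sup>2 - B\<^sup>2\<close> were bounded
  below, then \<open>\<parallel>Bx\<parallel>\<close> would be at most \<open>m'\<parallel>x\<parallel>\<close> for some \<open>m' < m\<close>.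
\<close>

lemma norm_square_not_invertible:
  assumes sa: "selfadjoint_op B" and nz: "B \<noteq> 0"
  shows "\<not> invertible_op ((norm B)\<^sup>2 *\<^sub>R id_blinfun - (B o\<^sub>L B))"
proof
  define m where "m = norm B"
  have m: "m > 0" using nz by (simp add: m_def)
  assume "invertible_op ((norm B)\<^sup>2 *\<^sub>R id_blinfun - (B o\<^sub>L B))"
  then obtain k where k: "k > 0" "\<And>x. norm x \<le> k * norm (((norm B)\<^sup>2 *\<^sub>R id_blinfun - (B o\<^sub>L B)) x)"
    using invertible_bounded_below by blast
  define e where "e = 1 / (k\<^sup>2 * m\<^sup>2)"
  have e: "e > 0" using k m by (simp add: e_def)
  have bound: "(norm (B x))\<^sup>2 \<le> (m\<^sup>2 - e) * (norm x)\<^sup>2" for x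
  proof -
    have "(norm x)\<^sup>2 \<le> k\<^sup>2 * (norm (m\<^sup>2 *\<^sub>R x - B (B x)))\<^sup>2"
      using power_mono[OF k(2)[of x] norm_ge_zero, of 2]
      by (simp add: m_def power_mult_distrib blinfun.bilinear_simps)
    also have "(norm (m\<^sup>2 *\<^sub>R x - B (B x)))\<^sup>2
      = m\<^sup>2 * (m\<^sup>2 * (norm x)\<^sup>2) - 2 * (m\<^sup>2 * (norm (B x))\<^sup>2) + (norm (B (B x)))\<^sup>2"
      unfolding Re_cinner_self[symmetric]
      using selfadjoint_cinner[OF sa, of x "B x"] selfadjoint_cinner[OF sa, of "B x" x]
      by (simp add: cinner_simps algebra_simps)
    also have "(norm (B (B x)))\<^sup>2 \<le> m\<^sup>2 * (norm (B x))\<^sup>2"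
      using norm_blinfun[of B "B x"] unfolding m_def
      by (metis norm_ge_zero power_mono power_mult_distrib)
    finally have "(norm x)\<^sup>2 \<le> k\<^sup>2 * (m\<^sup>2 * (m\<^sup>2 * (norm x)\<^sup>2 - (norm (B x))\<^sup>2))"
      by (simp add: right_diff_distrib mult_left_mono)
    then have "e * (norm x)\<^sup>2 \<le> m\<^sup>2 * (norm x)\<^sup>2 - (norm (B x))\<^sup>2"
      using k m by (simp add: e_def field_simps)
    then show ?thesis by (simp add: algebra_simps)
  qed
  \<comment> \<open>The bound itself forces \<open>m\<^sup>2 - e \<ge> 0\<close>; the maximum saves deriving it.\<close>
  define c where "c = sqrt (max 0 (m\<^sup>2 - e))"
  have "norm B \<le> c"
  proof (rule norm_blinfun_bound)
    show "0 \<le> c" by (simp add: c_def)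
    fix x
    have "(norm (B x))\<^sup>2 \<le> max 0 (m\<^sup>2 - e) * (norm x)\<^sup>2"
      using bound[of x] by (meson max.cobounded2 mult_right_mono order_trans zero_le_power2)
    also have "\<dots> = (c * norm x)\<^sup>2"
      by (simp add: c_def power_mult_distrib)
    finally show "norm (B x) \<le> c * norm x"
      by (rule power2_le_imp_le) (simp add: c_def)
  qed
  moreover have "c < m"
    unfolding c_def using e m by (intro real_less_lsqrt) auto
  ultimately show False by (simp add: m_def)
qed

text \<open>
  If \<open>m = \<parallel>p(A)\<parallel>\<close> exceeded \<open>c\<close>, then \<open>m\<^sup>2 - p\<^sup>2\<close> would have no zero on the spectrum, and
  \<open>m\<^sup>2 - p(A)\<^sup>2\<close> would be invertible.
\<close>

lemma norm_poly_op_le: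
  fixes A :: "'a::chilbert_space \<Rightarrow>\<^sub>L 'a"
  assumes sa: "selfadjoint_op A" and "0 \<le> c"
    and le: "\<And>t. t \<in> real_spectrum A \<Longrightarrow> \<bar>poly p t\<bar> \<le> c"
  shows "norm (poly_op p A) \<le> c"
proof (rule ccontr)
  assume gt: "\<not> norm (poly_op p A) \<le> c"
  define m where "m = norm (poly_op p A)"
  have m: "c < m" "0 < m"
    using gt \<open>0 \<le> c\<close> by (auto simp: m_def)
  define q where "q = [:m\<^sup>2:] - p * p"
  have "poly q t \<noteq> 0" if "t \<in> real_spectrum A" for t
  proof -
    have "(poly p t)\<^sup>2 < m\<^sup>2"
      using le[OF that] m by (metis abs_ge_zero order_le_less_trans power2_abs power_strict_mono zero_less_numeral)
    then show ?thesis by (simp add: q_def power2_eq_square)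
  qed
  moreover have "poly_op q A = (norm (poly_op p A))\<^sup>2 *\<^sub>R id_blinfun - (poly_op p A o\<^sub>L poly_op p A)"
    by (simp add: q_def m_def poly_op_diff poly_op_const poly_op_mult)
  moreover have "\<not> invertible_op ((norm (poly_op p A))\<^sup>2 *\<^sub>R id_blinfun - (poly_op p A o\<^sub>L poly_op p A))"
    using m by (intro norm_square_not_invertible selfadjoint_poly_op sa) (auto simp: m_def)
  ultimately have "q = 0"
    using poly_op_invertible[OF sa] by metis
  \<comment> \<open>So the spectrum is empty, which happens only on the zero space.\<close>
  then have empty: "t \<notin> real_spectrum A" for t
    using \<open>\<And>t. t \<in> real_spectrum A \<Longrightarrow> poly q t \<noteq> 0\<close> by auto
  have "A = 0"
  proof (rule ccontr)
    assume "A \<noteq> 0"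
    have "[:(norm A)\<^sup>2:] - [:0, 1:] * [:0, 1:] \<noteq> 0" by simp
    then have "invertible_op (poly_op ([:(norm A)\<^sup>2:] - [:0, 1:] * [:0, 1:]) A)"
      using poly_op_invertible[OF sa] empty by blast
    then have "invertible_op ((norm A)\<^sup>2 *\<^sub>R id_blinfun - (A o\<^sub>L A))"
      unfolding poly_op_diff poly_op_mult poly_op_const poly_op_X .
    with norm_square_not_invertible[OF sa \<open>A \<noteq> 0\<close>] show False by blast
  qed
  moreover have "invertible_op (A - 0 *\<^sub>R id_blinfun)"
    using empty[of 0] real_spectrum_iff[of 0 A] by blast
  ultimately have "invertible_op (0 :: 'a \<Rightarrow>\<^sub>L 'a)"
    by simp
  then have "id_blinfun = (0 :: 'a \<Rightarrow>\<^sub>L 'a)"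
    by (auto simp: invertible_op_def compose_simps)
  then have "poly_op p A = 0"
    by (metis blinfun_compose_id(1) bounded_bilinear.zero_right[OF bounded_bilinear_blinfun_compose])
  with m show False by (simp add: m_def)
qed

section \<open>Continuous functional calculus\<close>

text \<open>
  \<open>fun_op f A\<close> is the unique operator in this relation. Working with the relation instead of the
  description lets sums and products of functions be treated by limit theorems alone.
\<close>

definition has_fun_op :: "('a::complex_inner \<Rightarrow>\<^sub>L 'a) \<Rightarrow> (real \<Rightarrow> real) \<Rightarrow> ('a \<Rightarrow>\<^sub>L 'a) \<Rightarrow> bool"
  where "has_fun_op A f B \<longleftrightarrow> (\<exists>p. uniform_limit (real_spectrum A) (\<lambda>n. poly (p n)) f sequentially \<and>
    (\<lambda>n. poly_op (p n) A) \<longlonglongrightarrow> B)"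

lemma has_fun_op_poly: "has_fun_op A (poly p) (poly_op p A)"
  unfolding has_fun_op_def by (intro exI[of _ "\<lambda>_. p"]) (auto intro: uniform_limit_const)

lemma has_fun_op_cong:
  assumes "has_fun_op A f B" "\<And>t. t \<in> real_spectrum A \<Longrightarrow> f t = g t"
  shows "has_fun_op A g B"
proof -
  have "uniform_limit (real_spectrum A) h f sequentially \<longleftrightarrow> uniform_limit (real_spectrum A) h g sequentially" for h
    using assms(2) by (intro uniform_limit_cong') auto
  with assms(1) show ?thesis by (simp add: has_fun_op_def)
qed

lemma has_fun_op_const: "has_fun_op A (\<lambda>_. c) (c *\<^sub>R id_blinfun)"
  using has_fun_op_cong[OF has_fun_op_poly[of A "[:c:]"], of "\<lambda>_. c"] by (simp add: poly_op_const)

lemma has_fun_op_ident: "has_fun_op A (\<lambda>t. t) A"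
  using has_fun_op_cong[OF has_fun_op_poly[of A "[:0, 1:]"], of "\<lambda>t. t"] by (simp add: poly_op_X)

lemma has_fun_op_diff:
  assumes "has_fun_op A f B" "has_fun_op A g C"
  shows "has_fun_op A (\<lambda>t. f t - g t) (B - C)"
proof -
  obtain p q where p: "uniform_limit (real_spectrum A) (\<lambda>n. poly (p n)) f sequentially"
      "(\<lambda>n. poly_op (p n) A) \<longlonglongrightarrow> B"
    and q: "uniform_limit (real_spectrum A) (\<lambda>n. poly (q n)) g sequentially"
      "(\<lambda>n. poly_op (q n) A) \<longlonglongrightarrow> C"
    using assms unfolding has_fun_op_def by blast
  have "uniform_limit (real_spectrum A) (\<lambda>n. poly (p n - q n)) (\<lambda>t. f t - g t) sequentially"
    using uniform_limit_minus[OF p(1) q(1)] by (simp flip: poly_diff)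
  moreover have "(\<lambda>n. poly_op (p n - q n) A) \<longlonglongrightarrow> B - C"
    using tendsto_diff[OF p(2) q(2)] by (simp add: poly_op_diff)
  ultimately show ?thesis
    unfolding has_fun_op_def by (intro exI[of _ "\<lambda>n. p n - q n"] conjI)
qed

lemma has_fun_op_mult:
  assumes "has_fun_op A f B" "has_fun_op A g C"
    and bdd: "bounded (f ` real_spectrum A)" "bounded (g ` real_spectrum A)"
  shows "has_fun_op A (\<lambda>t. f t * g t) (B o\<^sub>L C)"
proof -
  obtain p q where p: "uniform_limit (real_spectrum A) (\<lambda>n. poly (p n)) f sequentially"
      "(\<lambda>n. poly_op (p n) A) \<longlonglongrightarrow> B"
    and q: "uniform_limit (real_spectrum A) (\<lambda>n. poly (q n)) g sequentially"
      "(\<lambda>n. poly_op (q n) A) \<longlonglongrightarrow> C"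
    using assms unfolding has_fun_op_def by blast
  have "uniform_limit (real_spectrum A) (\<lambda>n. poly (p n * q n)) (\<lambda>t. f t * g t) sequentially"
    using uniform_lim_mult[OF p(1) q(1) bdd] by (simp flip: poly_mult)
  moreover have "(\<lambda>n. poly_op (p n * q n) A) \<longlonglongrightarrow> (B o\<^sub>L C)"
    using bounded_bilinear.tendsto[OF bounded_bilinear_blinfun_compose p(2) q(2)]
    by (simp add: poly_op_mult)
  ultimately show ?thesis
    unfolding has_fun_op_def by (intro exI[of _ "\<lambda>n. p n * q n"] conjI)
qed

lemma has_fun_op_selfadjoint:
  assumes "has_fun_op A f B" and sa: "selfadjoint_op A"
  shows "selfadjoint_op B"
proof -
  obtain p where "(\<lambda>n. poly_op (p n) A) \<longlonglongrightarrow> B"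
    using assms unfolding has_fun_op_def by blast
  then have lim: "(\<lambda>n. poly_op (p n) A x) \<longlonglongrightarrow> B x" for x
    by (intro blinfun.tendsto) auto
  have sap: "selfadjoint_op (poly_op (p n) A)" for n
    by (rule selfadjoint_poly_op[OF sa])
  have "B (c *\<^sub>C x) = c *\<^sub>C B x" for c x
  proof (rule LIMSEQ_unique[OF lim])
    have "(\<lambda>n. scalar_op c (poly_op (p n) A x)) \<longlonglongrightarrow> scalar_op c (B x)"
      by (intro blinfun.tendsto tendsto_const lim)
    then show "(\<lambda>n. poly_op (p n) A (c *\<^sub>C x)) \<longlonglongrightarrow> c *\<^sub>C B x"
      using sap by (simp add: scalar_op.rep_eq selfadjoint_op_def clinear_op_def)
  qed
  moreover have "cinner (B x) y = cinner x (B y)" for x y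
  proof (rule LIMSEQ_unique)
    show "(\<lambda>n. cinner (poly_op (p n) A x) y) \<longlonglongrightarrow> cinner (B x) y"
      by (intro bounded_bilinear.tendsto[OF bounded_bilinear_cinner] lim tendsto_const)
    show "(\<lambda>n. cinner (poly_op (p n) A x) y) \<longlonglongrightarrow> cinner x (B y)"
      using bounded_bilinear.tendsto[OF bounded_bilinear_cinner tendsto_const[of x] lim[of y]] sap by (simp add: selfadjoint_cinner)
  qed
  ultimately show ?thesis by (simp add: selfadjoint_op_def clinear_op_def)
qed

lemma has_fun_op_norm_le:
  fixes A :: "'a::chilbert_space \<Rightarrow>\<^sub>L 'a"
  assumes "has_fun_op A f B" and sa: "selfadjoint_op A" and "0 \<le> c"
    and le: "\<And>t. t \<in> real_spectrum A \<Longrightarrow> \<bar>f t\<bar> \<le> c"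
  shows "norm B \<le> c"
proof (rule field_le_epsilon)
  fix e :: real assume e: "e > 0"
  obtain p where p: "uniform_limit (real_spectrum A) (\<lambda>n. poly (p n)) f sequentially"
    "(\<lambda>n. poly_op (p n) A) \<longlonglongrightarrow> B"
    using assms(1) unfolding has_fun_op_def by blast
  have "eventually (\<lambda>n. \<forall>t\<in>real_spectrum A. dist (poly (p n) t) (f t) < e) sequentially"
    using uniform_limitD[OF p(1) e] .
  then have "eventually (\<lambda>n. norm (poly_op (p n) A) \<le> c + e) sequentially"
  proof eventually_elim
    case (elim n)
    show ?case
    proof (rule norm_poly_op_le[OF sa])
      fix t assume t: "t \<in> real_spectrum A"
      show "\<bar>poly (p n) t\<bar> \<le> c + e"
        using elim[rule_format, OF t] le[OF t] unfolding dist_real_def by linarith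
    qed (use e \<open>0 \<le> c\<close> in simp)
  qed
  then show "norm B \<le> c + e"
    by (rule tendsto_upperbound[OF tendsto_norm[OF p(2)]]) simp
qed

lemma has_fun_op_unique:
  fixes A :: "'a::chilbert_space \<Rightarrow>\<^sub>L 'a"
  assumes "has_fun_op A f B" "has_fun_op A f C" and sa: "selfadjoint_op A"
  shows "B = C"
proof -
  have "norm (B - C) \<le> 0"
    using has_fun_op_norm_le[OF has_fun_op_diff[OF assms(1,2)] sa, of 0] by simp
  then show ?thesis by simp
qed

lemma fun_op_eqI:
  fixes A :: "'a::chilbert_space \<Rightarrow>\<^sub>L 'a"
  assumes "has_fun_op A f B" "selfadjoint_op A"
  shows "fun_op f A = B"
  unfolding fun_op_def has_fun_op_def[symmetric]
  using assms has_fun_op_unique by blast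

text \<open>
  If \<open>0 \<le> f \<le> K\<close> on the spectrum, then \<open>\<parallel>K - B\<parallel> \<le> K\<close>, hence \<open>\<langle>(K - B)x,x\<rangle> \<le> K\<parallel>x\<parallel>\<^sup>2\<close>.
\<close>

lemma has_fun_op_positive:
  fixes A :: "'a::chilbert_space \<Rightarrow>\<^sub>L 'a"
  assumes f: "has_fun_op A f B" and sa: "selfadjoint_op A"
    and bdd: "bounded (f ` real_spectrum A)" and pos: "\<And>t. t \<in> real_spectrum A \<Longrightarrow> 0 \<le> f t"
  shows "positive_op B"
proof -
  obtain K where K: "K > 0" "\<And>t. t \<in> real_spectrum A \<Longrightarrow> \<bar>f t\<bar> \<le> K"
    using bdd unfolding bounded_pos by auto
  have norm: "norm (K *\<^sub>R id_blinfun - B) \<le> K"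
  proof (rule has_fun_op_norm_le[OF has_fun_op_diff[OF has_fun_op_const f] sa])
    show "\<bar>K - f t\<bar> \<le> K" if "t \<in> real_spectrum A" for t
      using K(2)[OF that] pos[OF that] by linarith
  qed (use K in simp)
  have "0 \<le> Re (cinner (B x) x)" for x
  proof -
    have "Re (cinner ((K *\<^sub>R id_blinfun - B) x) x) \<le> norm ((K *\<^sub>R id_blinfun - B) x) * norm x"
      by (rule Re_cinner_le_norm)
    also have "\<dots> \<le> (K * norm x) * norm x"
      using norm_blinfun[of "K *\<^sub>R id_blinfun - B" x] norm
      by (meson mult_right_mono norm_ge_zero order_trans)
    finally show ?thesis
      by (simp add: blinfun.bilinear_simps cinner_simps Re_cinner_self power2_eq_square)
  qed
  then show ?thesis
    using has_fun_op_selfadjoint[OF f sa] by (simp add: positive_op_iff)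
qed

text \<open>
  By the norm estimate, polynomials that converge uniformly on \<open>[a, b]\<close> form a Cauchy sequence when
  evaluated at \<open>A\<close>.
\<close>

lemma has_fun_op_exists:
  fixes A :: "'a::chilbert_space \<Rightarrow>\<^sub>L 'a"
  assumes sa: "selfadjoint_op A" and ab: "real_spectrum A \<subseteq> {a..b}" and cont: "continuous_on {a..b} f"
  obtains B where "has_fun_op A f B"
proof -
  have "\<exists>p. \<forall>t\<in>{a..b}. \<bar>poly p t - f t\<bar> < 1 / real (Suc n)" for n
  proof -
    obtain g where g: "real_polynomial_function g" "\<And>x. x \<in> {a..b} \<Longrightarrow> \<bar>f x - g x\<bar> < 1 / real (Suc n)"
      using Stone_Weierstrass_real_polynomial_function[OF _ cont, of "1 / real (Suc n)"] by auto
    obtain c N where "g = (\<lambda>x. \<Sum>i\<le>N. c i * x ^ i)"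
      using g(1) real_polynomial_function_iff_sum by blast
    then have "g = poly (\<Sum>i\<le>N. monom (c i) i)"
      by (simp add: poly_sum poly_monom fun_eq_iff)
    with g(2) show ?thesis
      by (intro exI[of _ "\<Sum>i\<le>N. monom (c i) i"]) (simp add: abs_minus_commute)
  qed
  then obtain p where p: "\<And>n t. t \<in> {a..b} \<Longrightarrow> \<bar>poly (p n) t - f t\<bar> < 1 / real (Suc n)"
    by metis
  have lim: "uniform_limit (real_spectrum A) (\<lambda>n. poly (p n)) f sequentially"
  proof (rule uniform_limitI)
    fix e :: real assume "e > 0"
    then have "eventually (\<lambda>n. 1 / real (Suc n) < e) sequentially"
      using order_tendstoD(2)[OF LIMSEQ_inverse_real_of_nat] by (simp add: inverse_eq_divide)
    then show "eventually (\<lambda>n. \<forall>t\<in>real_spectrum A. dist (poly (p n) t) (f t) < e) sequentially"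
    proof eventually_elim
      case (elim n)
      then show ?case
        using p[of _ n] ab unfolding dist_real_def by (blast intro: order_less_trans)
    qed
  qed
  have "Cauchy (\<lambda>n. poly_op (p n) A)"
  proof (rule metric_CauchyI)
    fix e :: real assume e: "e > 0"
    then obtain M where M: "\<And>n. n \<ge> M \<Longrightarrow> \<forall>t\<in>real_spectrum A. dist (poly (p n) t) (f t) < e / 3"
      using uniform_limitD[OF lim, of "e / 3"] by (auto simp: eventually_sequentially)
    have "dist (poly_op (p m) A) (poly_op (p n) A) < e" if "m \<ge> M" "n \<ge> M" for m n
    proof -
      have "norm (poly_op (p m - p n) A) \<le> 2 * e / 3"
      proof (rule norm_poly_op_le[OF sa])
        fix t assume t: "t \<in> real_spectrum A"
        show "\<bar>poly (p m - p n) t\<bar> \<le> 2 * e / 3"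
          using M[OF that(1), rule_format, OF t] M[OF that(2), rule_format, OF t]
          unfolding dist_real_def poly_diff by linarith
      qed (use e in simp)
      then show ?thesis
        using e by (simp add: poly_op_diff dist_norm)
    qed
    then show "\<exists>M. \<forall>m\<ge>M. \<forall>n\<ge>M. dist (poly_op (p m) A) (poly_op (p n) A) < e" by blast
  qed
  then obtain B where "(\<lambda>n. poly_op (p n) A) \<longlonglongrightarrow> B"
    using Cauchy_convergent convergent_def by blast
  with lim that show ?thesis
    unfolding has_fun_op_def by blast
qed

lemma has_fun_op_fun_op:
  fixes A :: "'a::chilbert_space \<Rightarrow>\<^sub>L 'a"
  assumes "selfadjoint_op A" "real_spectrum A \<subseteq> {a..b}" "continuous_on {a..b} f"
  shows "has_fun_op A f (fun_op f A)"
  using has_fun_op_exists[OF assms] fun_op_eqI assms(1) by metis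

section \<open>The inequality\<close>

lemma powr_op_half:
  fixes R :: "'a::chilbert_space \<Rightarrow>\<^sub>L 'a"
  assumes "strictly_positive_op R"
  defines "S \<equiv> powr_op R (1/2)" and "T \<equiv> powr_op R (-1/2)"
  shows "selfadjoint_op S" "selfadjoint_op T" "S o\<^sub>L S = R" "S o\<^sub>L T = id_blinfun" "T o\<^sub>L S = id_blinfun"
proof -
  have sa: "selfadjoint_op R"
    using assms by (simp add: strictly_positive_op_def positive_imp_selfadjoint)
  obtain a b where ab: "0 < a" "real_spectrum R \<subseteq> {a..b}"
    by (rule strictly_positive_real_spectrum[OF assms(1)])
  have cont: "continuous_on {a..b} (\<lambda>t. t powr c)" for c
    using ab(1) by (intro continuous_intros) auto
  have bdd: "bounded ((\<lambda>t. t powr c) ` real_spectrum R)" for c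
    using compact_imp_bounded[OF compact_continuous_image[OF cont compact_Icc]] ab(2)
    by (meson bounded_subset image_mono)
  have fc: "has_fun_op R (\<lambda>t. t powr c) (powr_op R c)" for c
    unfolding powr_op_def by (rule has_fun_op_fun_op[OF sa ab(2) cont])
  have prod: "has_fun_op R (\<lambda>t. t powr (c + d)) (powr_op R c o\<^sub>L powr_op R d)" for c d
    using has_fun_op_mult[OF fc fc bdd bdd] by (simp add: powr_add)
  have pos: "0 < t" if "t \<in> real_spectrum R" for t
    using that ab by fastforce
  show "selfadjoint_op S" "selfadjoint_op T"
    unfolding S_def T_def using has_fun_op_selfadjoint[OF fc sa] by blast+
  have "has_fun_op R (\<lambda>t. t) (S o\<^sub>L S)"
    by (rule has_fun_op_cong[OF prod[of "1/2" "1/2", folded S_def]]) (use pos in \<open>simp add: less_imp_le\<close>)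
  then show "S o\<^sub>L S = R"
    using has_fun_op_unique[OF _ has_fun_op_ident sa] by blast
  have "has_fun_op R (\<lambda>t. 1) (S o\<^sub>L T)"
    by (rule has_fun_op_cong[OF prod[of "1/2" "-1/2", folded S_def T_def]]) (use pos in force)
  then show "S o\<^sub>L T = id_blinfun"
    using has_fun_op_unique[OF _ has_fun_op_const[of R 1] sa] by simp
  have "has_fun_op R (\<lambda>t. 1) (T o\<^sub>L S)"
    by (rule has_fun_op_cong[OF prod[of "-1/2" "1/2", folded S_def T_def]]) (use pos in force)
  then show "T o\<^sub>L S = id_blinfun"
    using has_fun_op_unique[OF _ has_fun_op_const[of R 1] sa] by simp
qed

text \<open>The scalar inequality \<open>t log t \<ge> t - 1\<close> lifted to operators.\<close>

lemma compose_log_op_ge: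
  fixes B :: "'a::chilbert_space \<Rightarrow>\<^sub>L 'a"
  assumes "strictly_positive_op B"
  shows "B - id_blinfun \<preceq> B o\<^sub>L log_op B"
proof -
  have sa: "selfadjoint_op B"
    using assms by (simp add: strictly_positive_op_def positive_imp_selfadjoint)
  obtain a b where ab: "0 < a" "real_spectrum B \<subseteq> {a..b}"
    by (rule strictly_positive_real_spectrum[OF assms])
  have bdd: "bounded (f ` real_spectrum B)" if "continuous_on {a..b} f" for f :: "real \<Rightarrow> real"
    using compact_imp_bounded[OF compact_continuous_image[OF that compact_Icc]] ab(2)
    by (meson bounded_subset image_mono)
  have cont: "continuous_on {a..b} ln"
    using ab(1) by (intro continuous_intros) auto
  have ln: "has_fun_op B ln (log_op B)"
    unfolding log_op_def by (rule has_fun_op_fun_op[OF sa ab(2) cont])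
  have "has_fun_op B (\<lambda>t. t * ln t) (B o\<^sub>L log_op B)"
    by (intro has_fun_op_mult has_fun_op_ident ln bdd cont continuous_on_id)
  then have "has_fun_op B (\<lambda>t. t * ln t - (t - 1)) ((B o\<^sub>L log_op B) - (B - 1 *\<^sub>R id_blinfun))"
    by (intro has_fun_op_diff has_fun_op_ident has_fun_op_const)
  then have "positive_op ((B o\<^sub>L log_op B) - (B - 1 *\<^sub>R id_blinfun))"
  proof (rule has_fun_op_positive[OF _ sa])
    show "bounded ((\<lambda>t. t * ln t - (t - 1)) ` real_spectrum B)"
      by (intro bdd continuous_on_diff continuous_on_mult continuous_on_id continuous_on_const cont)
    fix t assume "t \<in> real_spectrum B"
    with ab have t: "t > 0" by fastforce
    \<comment> \<open>\<open>log s \<le> s - 1\<close> at \<open>s = 1/t\<close>, multiplied by \<open>t\<close>\<close>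
    have "t * ln (1 / t) \<le> t * (1 / t - 1)"
      using t ln_le_minus_one[of "1 / t"] by (intro mult_left_mono) auto
    also have "\<dots> = 1 - t"
      using t by (simp add: field_simps)
    finally show "0 \<le> t * ln t - (t - 1)"
      using t by (simp add: ln_div)
  qed
  then show ?thesis by (simp add: le_op_def)
qed

lemma strictly_positive_congruence:
  assumes "selfadjoint_op T" "invertible_op T" "strictly_positive_op A"
  shows "strictly_positive_op (T o\<^sub>L A o\<^sub>L T)"
  using assms by (simp add: strictly_positive_op_def positive_congruence invertible_compose)

text \<open>Conjugate \<open>B - 1 \<le> B log B\<close> by \<open>R\<^sup>1\<^sup>/\<^sup>2\<close>, where \<open>B = R\<^sup>-\<^sup>1\<^sup>/\<^sup>2 L R\<^sup>-\<^sup>1\<^sup>/\<^sup>2\<close>.\<close>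

lemma log_op_inequality:
  fixes L R :: "'a::chilbert_space \<Rightarrow>\<^sub>L 'a"
  assumes "strictly_positive_op L" "strictly_positive_op R"
  shows "L - R \<preceq> L o\<^sub>L powr_op R (-1/2) o\<^sub>L
    log_op (powr_op R (-1/2) o\<^sub>L L o\<^sub>L powr_op R (-1/2)) o\<^sub>L powr_op R (1/2)"
proof -
  define S T where "S = powr_op R (1/2)" and "T = powr_op R (-1/2)"
  note ST = powr_op_half[OF assms(2), folded S_def T_def]
  define B where "B = T o\<^sub>L L o\<^sub>L T"
  have "invertible_op T"
    using ST(4,5) by (auto simp: invertible_op_def)
  then have "strictly_positive_op B"
    unfolding B_def using ST(2) assms(1) by (intro strictly_positive_congruence)
  then have "positive_op ((B o\<^sub>L log_op B) - (B - id_blinfun))"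
    using compose_log_op_ge by (simp add: le_op_def)
  then have pos: "positive_op (S o\<^sub>L ((B o\<^sub>L log_op B) - (B - id_blinfun)) o\<^sub>L S)"
    by (rule positive_congruence[OF ST(1)])
  have SB: "S o\<^sub>L B = L o\<^sub>L T"
    unfolding B_def by (simp add: blinfun_compose_assoc[symmetric] ST(4) blinfun_compose_id)
  have "S o\<^sub>L B o\<^sub>L S = L"
    unfolding SB by (simp add: blinfun_compose_assoc ST(5) blinfun_compose_id)
  moreover have "S o\<^sub>L (B o\<^sub>L log_op B) o\<^sub>L S = L o\<^sub>L T o\<^sub>L log_op B o\<^sub>L S"
    by (simp add: blinfun_compose_assoc[symmetric] SB)
  ultimately have "S o\<^sub>L ((B o\<^sub>L log_op B) - (B - id_blinfun)) o\<^sub>L S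
      = (L o\<^sub>L T o\<^sub>L log_op B o\<^sub>L S) - (L - R)"
    by (simp add: compose_simps ST(3))
  with pos show ?thesis
    unfolding le_op_def B_def S_def T_def by simp
qed

theorem mainTheorem8:
  fixes L R :: "nat \<Rightarrow> ('a::chilbert_space \<Rightarrow>\<^sub>L 'a)" and n :: nat
  assumes "\<And>i. i \<in> {1..n} \<Longrightarrow> strictly_positive_op (L i)"
    and "\<And>i. i \<in> {1..n} \<Longrightarrow> strictly_positive_op (R i)"
  shows "(\<Sum>i=1..n. L i - R i) \<preceq>
    (\<Sum>i=1..n. L i o\<^sub>L powr_op (R i) (-1/2) o\<^sub>L
       log_op (powr_op (R i) (-1/2) o\<^sub>L L i o\<^sub>L powr_op (R i) (-1/2)) o\<^sub>L
       powr_op (R i) (1/2))"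
proof -
  have "positive_op (\<Sum>i=1..n. (L i o\<^sub>L powr_op (R i) (-1/2) o\<^sub>L
       log_op (powr_op (R i) (-1/2) o\<^sub>L L i o\<^sub>L powr_op (R i) (-1/2)) o\<^sub>L
       powr_op (R i) (1/2)) - (L i - R i))"
    using assms log_op_inequality unfolding le_op_def by (intro positive_sum) blast
  then show ?thesis
    by (simp add: le_op_def sum_subtractf)
qed

end
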